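(* Let $\alpha>1/2$. There is no online algorithm for the strict dynamic case of \textsc{Knapsack} that has competitive ratio $\alpha$ and an amortized migration factor bounded by a constant (independent of the instance), when migration is measured by weight.
   Context: \textsc{Knapsack}: a capacity $C\in\mathbb N$ and items $i$ with weight $w_i\in\mathbb N$ and profit $p_i\in\mathbb N$; a subset is feasible iff its total weight is at most $C$, and its profit is the sum of its profits. Strict dynamic case: the instance starts empty, and at each time step one item arrives or one present item departs. The algorithm outputs a feasible $S_t$ at each time without knowledge of the future. Competitive ratio $\alpha$ means $\mathrm{profit}(S_t)\ge\alpha\,\mathrm{opt}(I_t)$ for all $t$. Migration measured by weight: the migration potential of a step is the weight of the arriving or departing item. The migration cost of changing $S_{t-1}$ to $S_t$ is the total weight of $S_{t-1}\triangle S_t$, excluding the initial inclusion of a newly arrived item. The amortized migration factor is bounded by $B$ if for every $t$ the total migration cost up to $t$ is at most $B$ times the total migration potential up to $t$. *)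

theory Defs
  imports Complex_Main
begin

text \<open>The identifier only serves to distinguish items with equal weight and profit.\<close>

datatype item = Item (ident: nat) (weight: nat) (profit: nat)

datatype event = Arrive (item_of: item) | Depart (item_of: item)

fun apply_event :: "event \<Rightarrow> item set \<Rightarrow> item set" where
  "apply_event (Arrive x) I = insert x I"
| "apply_event (Depart x) I = I - {x}"

text \<open>The items present after a sequence of events (earliest first), starting from none.\<close>

definition present :: "event list \<Rightarrow> item set" where
  "present es = fold apply_event es {}"

text \<open>Every arriving item is new: its identifier has not occurred before, so an item that
  comes back after its departure is a different item.\<close>

definition valid_events :: "event list \<Rightarrow> bool" where
  "valid_events es \<longleftrightarrow>
    (\<forall>t<length es. case es ! t of
        Arrive x \<Rightarrow> (\<forall>s<t. ident (item_of (es ! s)) \<noteq> ident x)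
      | Depart x \<Rightarrow> x \<in> present (take t es))"

definition feasible :: "nat \<Rightarrow> item set \<Rightarrow> item set \<Rightarrow> bool" where
  "feasible C I S \<longleftrightarrow> S \<subseteq> I \<and> sum weight S \<le> C"

definition opt :: "nat \<Rightarrow> item set \<Rightarrow> nat" where
  "opt C I = Max (sum profit ` {S. feasible C I S})"

text \<open>A (deterministic) algorithm maps the capacity and the events seen so far to its current
  solution, so its output at time \<open>t\<close> cannot depend on later events.\<close>

type_synonym algorithm = "nat \<Rightarrow> event list \<Rightarrow> item set"

definition solution :: "algorithm \<Rightarrow> nat \<Rightarrow> event list \<Rightarrow> nat \<Rightarrow> item set" where
  "solution A C es t = A C (take t es)"

definition online_algorithm :: "algorithm \<Rightarrow> bool" where
  "online_algorithm A \<longleftrightarrow>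
    (\<forall>C es t. valid_events es \<longrightarrow> t \<le> length es \<longrightarrow>
      feasible C (present (take t es)) (solution A C es t))"

definition competitive :: "real \<Rightarrow> algorithm \<Rightarrow> bool" where
  "competitive \<alpha> A \<longleftrightarrow>
    (\<forall>C es t. valid_events es \<longrightarrow> t \<le> length es \<longrightarrow>
      real (sum profit (solution A C es t)) \<ge> \<alpha> * real (opt C (present (take t es))))"

fun arriving :: "event \<Rightarrow> item set" where
  "arriving (Arrive x) = {x}"
| "arriving (Depart x) = {}"

text \<open>Step \<open>s\<close> is the event \<open>es ! s\<close>, leading from time \<open>s\<close> to time \<open>Suc s\<close>.\<close>

definition migration_potential :: "event list \<Rightarrow> nat \<Rightarrow> nat" where
  "migration_potential es s = weight (item_of (es ! s))"

definition migration_cost :: "algorithm \<Rightarrow> nat \<Rightarrow> event list \<Rightarrow> nat \<Rightarrow> nat" where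
  "migration_cost A C es s =
    sum weight (sym_diff (solution A C es s) (solution A C es (Suc s)) - arriving (es ! s))"

definition amortized_migration_factor_le :: "algorithm \<Rightarrow> real \<Rightarrow> bool" where
  "amortized_migration_factor_le A B \<longleftrightarrow>
    (\<forall>C es t. valid_events es \<longrightarrow> t \<le> length es \<longrightarrow>
      real (\<Sum>s<t. migration_cost A C es s) \<le> B * real (\<Sum>s<t. migration_potential es s))"

end

theory Submission
  imports Defs
begin

text \<open>An item of weight \<open>C\<close> and profit 1 stays present while unit-weight items of profit 2
  arrive and depart in turn. The heavy item is packed whenever it is alone and, since it does not
  fit together with a unit item, is dropped whenever a unit item is present. Hence every step
  after the first costs at least \<open>C\<close> but has potential 1, and \<open>2 C\<close> such steps cost \<open>2 C\<^sup>2\<close>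
  against a total potential of \<open>3 C\<close>.\<close>

definition heavy :: "nat \<Rightarrow> item" where
  "heavy C = Item 0 C 1"

definition light :: "nat \<Rightarrow> item" where
  "light s = Item s 1 2"

text \<open>The step number serves as the identifier of each light item, and 0 as that of the heavy
  one, so every arrival is fresh as \<open>valid_events\<close> demands.\<close>

definition toggle :: "nat \<Rightarrow> nat \<Rightarrow> event" where
  "toggle C s = (if s = 0 then Arrive (heavy C)
    else if odd s then Arrive (light s) else Depart (light (s - 1)))"

definition toggles :: "nat \<Rightarrow> nat \<Rightarrow> event list" where
  "toggles C n = map (toggle C) [0..<n]"

lemma length_toggles [simp]: "length (toggles C n) = n"
  by (simp add: toggles_def)

lemma nth_toggles [simp]: "s < n \<Longrightarrow> toggles C n ! s = toggle C s"
  by (simp add: toggles_def)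

lemma take_toggles [simp]: "t \<le> n \<Longrightarrow> take t (toggles C n) = toggles C t"
  by (simp add: toggles_def take_map)

lemma heavy_neq_light [simp]: "s > 0 \<Longrightarrow> heavy C \<noteq> light s"
  by (simp add: heavy_def light_def)

lemma present_toggles_Suc:
  "present (toggles C (Suc s)) = (if even s then {heavy C} else {heavy C, light s})"
proof (induction s)
  case 0
  then show ?case by (simp add: present_def toggles_def toggle_def)
next
  case (Suc s)
  have "present (toggles C (Suc (Suc s)))
      = apply_event (toggle C (Suc s)) (present (toggles C (Suc s)))"
    by (simp add: present_def toggles_def)
  then show ?case
    unfolding Suc.IH by (auto simp: toggle_def heavy_def light_def)
qed

text \<open>A departure at an even step \<open>t > 0\<close> concerns \<open>light (t - 1)\<close>,
  which \<open>present_toggles_Suc\<close> shows to be present.\<close>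

lemma valid_toggles: "valid_events (toggles C n)"
proof -
  have step: "case toggle C t of
        Arrive x \<Rightarrow> (\<forall>s<t. ident (item_of (toggle C s)) \<noteq> ident x)
      | Depart x \<Rightarrow> x \<in> present (toggles C t)" for t
  proof (cases t)
    case (Suc s)
    then show ?thesis
      by (auto simp: toggle_def light_def heavy_def present_toggles_Suc)
  qed (simp add: toggle_def)
  show ?thesis
    unfolding valid_events_def
  proof (intro allI impI)
    fix t assume "t < length (toggles C n)"
    then show "case toggles C n ! t of
        Arrive x \<Rightarrow> (\<forall>s<t. ident (item_of (toggles C n ! s)) \<noteq> ident x)
      | Depart x \<Rightarrow> x \<in> present (take t (toggles C n))"
      using step[of t] by (simp split: event.splits)
  qed
qed

text \<open>Used to bound \<open>opt\<close> from below by exhibiting a single solution; finiteness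
  of \<open>I\<close> ensures that \<open>Max\<close> ranges over a finite set.\<close>

lemma profit_le_opt:
  assumes "finite I" "feasible C I S"
  shows "sum profit S \<le> opt C I"
proof -
  have "{S. feasible C I S} \<subseteq> Pow I"
    by (auto simp: feasible_def)
  then have "finite {S. feasible C I S}"
    using assms(1) by (meson finite_Pow_iff finite_subset)
  then show ?thesis
    using assms(2) by (simp add: opt_def)
qed

text \<open>Competitiveness leaves no choice: a lone heavy item must be packed to get positive
  profit, and beside a light item it must be left out.\<close>

lemma heavy_mem_solution_toggles_iff:
  assumes "online_algorithm A" "competitive \<alpha> A" "\<alpha> > 1 / 2" "C > 0" "s < n"
  shows "heavy C \<in> solution A C (toggles C n) (Suc s) \<longleftrightarrow> even s"
proof -
  define S where "S = solution A C (toggles C n) (Suc s)"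
  define I where "I = present (toggles C (Suc s))"
  have feas: "feasible C I S"
    using assms(1,5) valid_toggles[of C n]
    unfolding online_algorithm_def S_def I_def
    by (metis Suc_leI length_toggles take_toggles)
  have comp: "\<alpha> * real (opt C I) \<le> real (sum profit S)"
    using assms(2,5) valid_toggles[of C n]
    unfolding competitive_def S_def I_def
    by (metis Suc_leI length_toggles take_toggles)
  have fin: "finite I"
    by (simp add: I_def present_toggles_Suc)
  show ?thesis
  proof (cases "even s")
    case True
    then have I: "I = {heavy C}"
      by (simp add: I_def present_toggles_Suc)
    have "1 \<le> opt C I"
      using profit_le_opt[OF fin, of C "{heavy C}"] by (simp add: I feasible_def heavy_def)
    then have "0 < \<alpha> * real (opt C I)"
      using assms(3) by (intro mult_pos_pos) auto
    then have "S \<noteq> {}"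
      using comp by auto
    then have "heavy C \<in> S"
      using feas by (auto simp: I feasible_def)
    then show ?thesis
      using True by (simp add: S_def)
  next
    case False
    then have s: "s > 0"
      by (cases s) auto
    have I: "I = {heavy C, light s}"
      using False by (simp add: I_def present_toggles_Suc)
    have "2 \<le> opt C I"
      using profit_le_opt[OF fin, of C "{light s}"] \<open>C > 0\<close>
      by (simp add: I feasible_def light_def)
    then have "\<alpha> * 2 \<le> \<alpha> * real (opt C I)"
      using assms(3) by (intro mult_left_mono) auto
    \<comment> \<open>The threshold 1/2 enters here: the heavy item alone earns exactly 1, half of
      the light item's profit.\<close>
    then have profit: "1 < sum profit S"
      using comp assms(3) by linarith
    have "heavy C \<notin> S"
    proof
      assume "heavy C \<in> S"
      then have "S = {heavy C} \<or> S = {heavy C, light s}"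
        using feas by (auto simp: I feasible_def)
      then show False
      proof
        assume "S = {heavy C}"
        with profit show False by (simp add: heavy_def)
      next
        assume "S = {heavy C, light s}"
        \<comment> \<open>Since \<open>s > 0\<close>, the two items are distinct, so their weights
          add up to \<open>C + 1\<close>.\<close>
        with feas s show False
          by (simp add: feasible_def) (simp add: heavy_def light_def)
      qed
    qed
    then show ?thesis
      using False by (simp add: S_def)
  qed
qed

text \<open>The heavy item enters or leaves the solution at each step after the first. Step 0 is
  left out because the initial inclusion of the heavy item is free.\<close>

lemma migration_cost_toggles_ge:
  assumes "online_algorithm A" "competitive \<alpha> A" "\<alpha> > 1 / 2" "C > 0" "Suc s < n"
  shows "C \<le> migration_cost A C (toggles C n) (Suc s)"
proof -
  let ?sol = "solution A C (toggles C n)"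
  let ?D = "sym_diff (?sol (Suc s)) (?sol (Suc (Suc s))) - arriving (toggles C n ! Suc s)"
  have "finite (?sol (Suc t))" if "t < n" for t
  proof -
    have "?sol (Suc t) \<subseteq> present (toggles C (Suc t))"
      using assms(1) valid_toggles[of C n] that
      unfolding online_algorithm_def feasible_def
      by (metis Suc_leI length_toggles take_toggles)
    then show ?thesis
      by (rule finite_subset) (simp add: present_toggles_Suc)
  qed
  then have "finite ?D"
    using assms(5) by simp
  moreover have "heavy C \<in> ?D"
    \<comment> \<open>Membership differs because \<open>s\<close> and \<open>Suc s\<close> have
      opposite parity, and the item possibly excluded by \<open>arriving\<close> is a light
      one.\<close>
    using assms heavy_mem_solution_toggles_iff[OF assms(1-4), of s n]
      heavy_mem_solution_toggles_iff[OF assms(1-5)]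
    by (auto simp: toggle_def)
  ultimately have "weight (heavy C) \<le> sum weight ?D"
    by (intro member_le_sum) auto
  then show ?thesis
    by (simp add: migration_cost_def heavy_def)
qed

lemma migration_potential_toggles:
  "s < n \<Longrightarrow> migration_potential (toggles C n) s = (if s = 0 then C else 1)"
  by (simp add: migration_potential_def toggle_def heavy_def light_def)

theorem theorem19:
  fixes \<alpha> :: real
  assumes "\<alpha> > 1 / 2"
  shows "\<not> (\<exists>A. online_algorithm A \<and> competitive \<alpha> A \<and>
    (\<exists>B. amortized_migration_factor_le A B))"
proof
  assume "\<exists>A. online_algorithm A \<and> competitive \<alpha> A \<and>
    (\<exists>B. amortized_migration_factor_le A B)"
  then obtain A B where A: "online_algorithm A" "competitive \<alpha> A"
    and B: "amortized_migration_factor_le A B"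
    by blast
  \<comment> \<open>The bound \<open>2 * C * C \<le> B * (3 * C)\<close> must fail; the maximum with
    0 keeps \<open>C\<close> positive even for negative \<open>B\<close>.\<close>
  obtain C :: nat where C: "real C > max 0 (3 * B / 2)"
    using reals_Archimedean2 by blast
  then have "C > 0" by simp
  define n where "n = Suc (2 * C)"
  let ?cost = "migration_cost A C (toggles C n)"
  let ?pot = "migration_potential (toggles C n)"
  have "(\<Sum>s<2 * C. C) \<le> (\<Sum>s<2 * C. ?cost (Suc s))"
    using migration_cost_toggles_ge[OF A assms \<open>C > 0\<close>] by (intro sum_mono) (simp add: n_def)
  \<comment> \<open>Splitting off step 0 only drops a nonnegative term.\<close>
  also have "\<dots> \<le> (\<Sum>s<n. ?cost s)"
    unfolding n_def sum.lessThan_Suc_shift by simp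
  finally have cost: "2 * C * C \<le> (\<Sum>s<n. ?cost s)"
    by simp
  have "(\<Sum>s<n. ?pot s) = (\<Sum>s<n. if s = 0 then C else 1)"
    by (intro sum.cong) (auto simp: migration_potential_toggles)
  also have "\<dots> = 3 * C"
    unfolding n_def sum.lessThan_Suc_shift by simp
  finally have pot: "(\<Sum>s<n. ?pot s) = 3 * C" .
  have "real (2 * C * C) \<le> real (\<Sum>s<n. ?cost s)"
    using cost by (rule of_nat_mono)
  also have "\<dots> \<le> B * real (\<Sum>s<n. ?pot s)"
    using B valid_toggles[of C n] unfolding amortized_migration_factor_le_def by simp
  finally have "real C * (2 * real C) \<le> real C * (3 * B)"
    by (simp add: pot algebra_simps)
  then have "2 * real C \<le> 3 * B"
    using \<open>C > 0\<close> by simp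
  with C show False by simp
qed

end
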